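(* Let $p$ be prime, let $n \ge 1$ be an integer, and write the base $p$ expansion of $n$ as $n = \sum_{j=0}^{k} a_j p^j$, with digits $0 \le a_j \le p-1$ and $a_k \neq 0$. Then $$\mathrm{ord}_p(\overline{G}_n) = \sum_{j=1}^{k} j a_j p^j - \left( \sum_{j=1}^{k} a_j \left(\frac{p^j - 1}{p-1}\right) + \sum_{j=0}^{k} \frac{1}{p^{j+1}} \Big( \sum_{u=0}^{j} a_u p^u \Big)\Big( \sum_{v=j+1}^{k} a_v p^v \Big) \right).$$
   Context: $\overline{G}_n := \prod_{t=0}^n \binom{n}{t}$. For a prime $p$ and a positive integer $m$, $\mathrm{ord}_p(m)$ is the exponent of the largest power of $p$ dividing $m$. Empty sums are $0$. *)

theory Defs
  imports Complex_Main "HOL-Computational_Algebra.Primes"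
begin

definition binomial_prod :: "nat \<Rightarrow> nat" where
  "binomial_prod n = (\<Prod>t=0..n. n choose t)"

end

theory Submission
  imports Defs
begin

text \<open>
  The identity has a local form for each power \<open>q = p ^ i\<close>. By Kummer's theorem the exponent of
  \<open>p\<close> in \<open>n choose t\<close> is the number of \<open>i \<ge> 1\<close> for which subtracting \<open>t\<close> from \<open>n\<close> borrows at
  position \<open>i\<close>, that is \<open>t mod p ^ i > n mod p ^ i\<close>. Among \<open>t = 0, \<dots>, n\<close> exactly
  \<open>(n div q) * (q - 1 - n mod q)\<close> values satisfy \<open>t mod q > n mod q\<close>: every complete block of
  length \<open>q\<close> contributes \<open>q - 1 - n mod q\<close> of them and the last, incomplete block none. Hence
  the exponent of \<open>p\<close> in the product of the binomials is
  \[ \sum_{i \ge 1} (n \mathbin{div} p^i) (p^i - 1 - n \mathbin{mod} p^i), \]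
  which is \<open>multiplicity_binomial_prod\<close>. It is proved without Kummer's theorem: passing from
  \<open>n\<close> to \<open>n + 1\<close> multiplies the product by \<open>(n + 1) ^ (n + 1) / (n + 1)!\<close>
  (\<open>fact_times_binomial_prod_Suc\<close>), and by Legendre's formula the increment of each borrow count
  (\<open>borrow_count_Suc\<close>) is the contribution of \<open>p ^ i\<close> to the exponent of that factor.

  With \<open>Q = n div p ^ i\<close> and \<open>R = n mod p ^ i\<close>, each summand splits as
  \<open>Q * p ^ i - Q - Q * R\<close>. Here \<open>R\<close> collects the digits below position \<open>i\<close> and \<open>Q * p ^ i\<close> the
  others (\<open>mod_power_eq_low_digits\<close>, \<open>div_power_times_power_eq_high_digits\<close>), and exchanging
  the order of summation turns the sums of the three parts over \<open>i\<close> into the three sums over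
  digits.
\<close>

section \<open>The recurrence for the product of a row of binomial coefficients\<close>

text \<open>
  The factor by which the product grows comes from
  \<open>(n + 1 - t) * (n + 1 choose t) = (n + 1) * (n choose t)\<close>, multiplied over \<open>t = 0, \<dots>, n\<close>.
\<close>

lemma fact_times_binomial_prod_Suc:
  "fact (Suc n) * binomial_prod (Suc n) = Suc n ^ Suc n * binomial_prod n"
proof -
  have "(\<Prod>t=0..n. Suc n - t) = (\<Prod>t=0..n. Suc t)"
    by (subst prod.atLeastAtMost_rev) (auto intro!: prod.cong)
  also have "\<dots> = fact (Suc n)"
    by (simp add: fact_prod_Suc atLeastLessThanSuc_atLeastAtMost del: fact_Suc)
  finally have "fact (Suc n) * binomial_prod (Suc n) =
      (\<Prod>t=0..n. (Suc n - t) * (Suc n choose t))"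
    by (simp add: binomial_prod_def prod.distrib del: fact_Suc)
  also have "\<dots> = (\<Prod>t=0..n. Suc n * (n choose t))"
  proof (rule prod.cong)
    fix t
    show "(Suc n - t) * (Suc n choose t) = Suc n * (n choose t)"
      using binomial_absorb_comp[of "Suc n" t] by simp
  qed simp
  also have "\<dots> = Suc n ^ Suc n * binomial_prod n"
    by (simp add: binomial_prod_def prod.distrib del: power_Suc mult_Suc)
  finally show ?thesis .
qed

lemma binomial_prod_pos: "binomial_prod n > 0"
  by (auto simp: binomial_prod_def intro!: prod_pos)

section \<open>Exponents of a prime as sums over its powers\<close>

lemma multiplicity_eq_sum_dvd:
  fixes p m k :: nat
  assumes "prime p" "m > 0" "m < p ^ Suc k"
  shows "multiplicity p m = (\<Sum>i=1..k. of_bool (p ^ i dvd m))"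
proof -
  have dvd_iff: "p ^ i dvd m \<longleftrightarrow> i \<le> multiplicity p m" for i
    using assms by (intro power_dvd_iff_le_multiplicity) (auto dest: prime_gt_1_nat)
  have "multiplicity p m \<le> k"
    using dvd_iff[of "Suc k"] dvd_imp_le[of "p ^ Suc k" m] assms by force
  then have "{1..k} \<inter> {i. p ^ i dvd m} = {1..multiplicity p m}"
    by (auto simp: dvd_iff)
  then show ?thesis by (simp add: of_bool_def sum.If_cases)
qed

lemma div_Suc_eq: "Suc n div q = n div q + of_bool (q dvd Suc n)"
  by (auto simp: div_Suc dvd_eq_mod_eq_0)

text \<open>Legendre's formula, cut off at a power of \<open>p\<close> beyond \<open>n\<close>.\<close>

lemma multiplicity_fact_eq_sum_div:
  fixes p n k :: nat
  assumes "prime p" "n < p ^ Suc k"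
  shows "multiplicity p (fact n) = (\<Sum>i=1..k. n div p ^ i)"
  using assms(2)
proof (induction n)
  case 0
  show ?case by simp
next
  case (Suc n)
  have "multiplicity p (fact (Suc n)) = multiplicity p (Suc n) + multiplicity p (fact n)"
    using assms(1) unfolding fact_Suc of_nat_id
    by (intro prime_elem_multiplicity_mult_distrib) auto
  with Suc multiplicity_eq_sum_dvd[OF assms(1), of "Suc n" k] show ?case
    by (simp add: div_Suc_eq sum.distrib)
qed

section \<open>Counting borrows\<close>

text \<open>
  The number of \<open>t \<le> n\<close> with \<open>t mod q > n mod q\<close>, in closed form: \<open>n div q\<close> complete blocks of
  length \<open>q\<close> with \<open>q - 1 - n mod q\<close> such \<open>t\<close> each.
\<close>

definition borrow_count :: "nat \<Rightarrow> nat \<Rightarrow> nat" where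
  "borrow_count q n = (n div q) * (q - 1 - n mod q)"

text \<open>
  If \<open>q\<close> divides \<open>n + 1\<close>, the residue drops from \<open>q - 1\<close>, which no \<open>t mod q\<close> exceeds, to \<open>0\<close>,
  which is exceeded by \<open>q - 1\<close> elements of each of the \<open>(n + 1) div q\<close> blocks. Otherwise the
  residue grows by one and each complete block loses one element.
\<close>

lemma borrow_count_Suc:
  assumes "q > 0"
  shows "borrow_count q (Suc n) + Suc n div q = Suc n * of_bool (q dvd Suc n) + borrow_count q n"
proof (cases "q dvd Suc n")
  case True
  then have "Suc (n mod q) = q"
    by (metis mod_Suc dvd_eq_mod_eq_0 nat.distinct(1))
  then have "borrow_count q n = 0"
    by (auto simp: borrow_count_def)
  moreover have "Suc n div q * (q - 1) + Suc n div q = Suc n"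
    using True assms by (metis Suc_diff_1 dvd_div_mult_self mult_Suc_right add.commute)
  ultimately show ?thesis
    using True by (simp add: borrow_count_def dvd_eq_mod_eq_0)
next
  case False
  then have mod: "Suc n mod q = Suc (n mod q)"
    by (metis mod_Suc dvd_eq_mod_eq_0)
  then have "Suc (n mod q) < q"
    using assms by (metis mod_less_divisor)
  then have "q - 1 - n mod q = Suc (q - 1 - Suc (n mod q))"
    by simp
  with False show ?thesis
    by (simp add: borrow_count_def mod div_Suc_eq)
qed

text \<open>
  The terms with \<open>i > k\<close> vanish because \<open>n < p ^ (k + 1)\<close>; a cut-off independent of \<open>n\<close> lets the
  induction on \<open>n\<close> compare the sums term by term.
\<close>

lemma multiplicity_binomial_prod:
  fixes p n k :: nat
  assumes p: "prime p" and "n < p ^ Suc k"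
  shows "multiplicity p (binomial_prod n) = (\<Sum>i=1..k. borrow_count (p ^ i) n)"
  using assms(2)
proof (induction n)
  case 0
  show ?case by (simp add: binomial_prod_def borrow_count_def)
next
  case (Suc n)
  have p0: "p ^ i > 0" for i
    using p by (simp add: prime_gt_0_nat)
  have "multiplicity p (fact (Suc n)) + multiplicity p (binomial_prod (Suc n)) =
      multiplicity p (fact (Suc n) * binomial_prod (Suc n))"
    using p binomial_prod_pos[of "Suc n"]
    by (subst prime_elem_multiplicity_mult_distrib) (auto simp del: fact_Suc)
  also have "\<dots> = multiplicity p (Suc n ^ Suc n * binomial_prod n)"
    by (simp only: fact_times_binomial_prod_Suc)
  also have "\<dots> = Suc n * multiplicity p (Suc n) + multiplicity p (binomial_prod n)"
    using p binomial_prod_pos[of n]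
    by (subst prime_elem_multiplicity_mult_distrib)
       (auto simp: prime_elem_multiplicity_power_distrib simp del: power_Suc)
  also have "\<dots> = (\<Sum>i=1..k. Suc n * of_bool (p ^ i dvd Suc n) + borrow_count (p ^ i) n)"
    by (simp only: multiplicity_eq_sum_dvd[OF p zero_less_Suc Suc.prems]
        Suc.IH[OF Suc_lessD[OF Suc.prems]] sum.distrib sum_distrib_left)
  also have "\<dots> = (\<Sum>i=1..k. borrow_count (p ^ i) (Suc n) + Suc n div p ^ i)"
    by (simp only: borrow_count_Suc[OF p0])
  also have "\<dots> = (\<Sum>i=1..k. borrow_count (p ^ i) (Suc n)) + multiplicity p (fact (Suc n))"
    by (simp only: sum.distrib multiplicity_fact_eq_sum_div[OF p Suc.prems])
  finally show ?case by simp
qed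

section \<open>Quotients and remainders in terms of digits\<close>

lemma digit_sum_less_power:
  fixes a :: "nat \<Rightarrow> nat"
  assumes "\<And>j. j < i \<Longrightarrow> a j < p"
  shows "(\<Sum>j<i. a j * p ^ j) < p ^ i"
  using assms
proof (induction i)
  case 0
  show ?case by simp
next
  case (Suc i)
  then have "(\<Sum>j<i. a j * p ^ j) < p ^ i" and "Suc (a i) \<le> p"
    by (auto simp: Suc_le_eq)
  then have "(\<Sum>j<Suc i. a j * p ^ j) < Suc (a i) * p ^ i"
    by simp
  also have "\<dots> \<le> p * p ^ i"
    using \<open>Suc (a i) \<le> p\<close> by (rule mult_le_mono1)
  finally show ?case by simp
qed

context
  fixes p n k :: nat and a :: "nat \<Rightarrow> nat"
  assumes n_eq: "n = (\<Sum>j=0..k. a j * p ^ j)"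
    and digit_less: "\<And>j. j \<le> k \<Longrightarrow> a j < p"
begin

lemma split_digits:
  assumes "i \<le> Suc k"
  shows "n = (\<Sum>v=i..k. a v * p ^ (v - i)) * p ^ i + (\<Sum>u<i. a u * p ^ u)"
proof -
  have "{0..k} = {..<i} \<union> {i..k}"
    using assms by auto
  then have "n = (\<Sum>u<i. a u * p ^ u) + (\<Sum>v=i..k. a v * p ^ v)"
    unfolding n_eq by (simp add: sum.union_disjoint ivl_disj_int)
  also have "(\<Sum>v=i..k. a v * p ^ v) = (\<Sum>v=i..k. a v * p ^ (v - i)) * p ^ i"
    unfolding sum_distrib_right
    by (intro sum.cong) (auto simp: mult.assoc simp flip: power_add)
  finally show ?thesis by simp
qed

lemma mod_power_eq_low_digits:
  assumes "i \<le> Suc k"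
  shows "n mod p ^ i = (\<Sum>u<i. a u * p ^ u)"
  using assms digit_less
  by (subst split_digits[OF assms]) (simp add: digit_sum_less_power)

lemma div_power_eq_high_digits:
  assumes "i \<le> Suc k"
  shows "n div p ^ i = (\<Sum>v=i..k. a v * p ^ (v - i))"
proof -
  have "(\<Sum>u<i. a u * p ^ u) < p ^ i"
    using assms digit_less by (intro digit_sum_less_power) auto
  then show ?thesis
    by (cases "p ^ i = 0"; subst split_digits[OF assms]) (simp_all del: power_eq_0_iff)
qed

lemma div_power_times_power_eq_high_digits:
  assumes "i \<le> Suc k"
  shows "n div p ^ i * p ^ i = (\<Sum>v=i..k. a v * p ^ v)"
  unfolding div_power_eq_high_digits[OF assms] sum_distrib_right
  by (intro sum.cong) (auto simp: mult.assoc simp flip: power_add)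

end

section \<open>Summation over digits\<close>

lemma sum_triangle_swap:
  fixes f :: "nat \<Rightarrow> nat \<Rightarrow> 'a::comm_monoid_add"
  shows "(\<Sum>i=1..k. \<Sum>v=i..k. f i v) = (\<Sum>v=1..k. \<Sum>i=1..v. f i v)"
proof (induction k)
  case 0
  show ?case by simp
next
  case (Suc k)
  have "(\<Sum>i=1..k. \<Sum>v=i..Suc k. f i v) = (\<Sum>i=1..k. (\<Sum>v=i..k. f i v) + f i (Suc k))"
    by (intro sum.cong) auto
  with Suc show ?case
    by (simp add: sum.distrib add.assoc)
qed

lemma sum_powers_down:
  fixes x :: "'a::field"
  assumes "x \<noteq> 1"
  shows "(\<Sum>i=1..v. x ^ (v - i)) = (x ^ v - 1) / (x - 1)"
proof -
  have "(\<Sum>i=1..v. x ^ (v - i)) = (\<Sum>i<v. x ^ i)"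
    by (rule sum.reindex_bij_witness[of _ "\<lambda>i. v - i" "\<lambda>i. v - i"]) auto
  then show ?thesis
    using geometric_sum[OF assms] by simp
qed

theorem theorem6p1:
  fixes p n k :: nat and a :: "nat \<Rightarrow> nat"
  assumes "prime p"
    and "n \<ge> 1"
    and "n = (\<Sum>j=0..k. a j * p ^ j)"
    and "\<And>j. j \<le> k \<Longrightarrow> a j \<le> p - 1"
    and "a k \<noteq> 0"
  shows "real (multiplicity p (binomial_prod n)) =
    (\<Sum>j=1..k. real j * real (a j) * real p ^ j)
    - ((\<Sum>j=1..k. real (a j) * ((real p ^ j - 1) / (real p - 1)))
       + (\<Sum>j=0..k. 1 / real p ^ (j + 1)
            * (\<Sum>u=0..j. real (a u) * real p ^ u)
            * (\<Sum>v=j+1..k. real (a v) * real p ^ v)))"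
proof -
  have p1: "p > 1"
    using assms(1) by (rule prime_gt_1_nat)
  have digit_less: "a j < p" if "j \<le> k" for j
    using assms(4)[OF that] p1 by linarith
  note high = div_power_eq_high_digits[OF assms(3) digit_less]
    and high_times = div_power_times_power_eq_high_digits[OF assms(3) digit_less]
    and low = mod_power_eq_low_digits[OF assms(3) digit_less]
  have "n < p ^ Suc k"
    using digit_sum_less_power[of "Suc k" a p] digit_less
    by (simp add: assms(3) lessThan_Suc_atMost atMost_atLeast0)
  then have "real (multiplicity p (binomial_prod n)) = (\<Sum>i=1..k. real (borrow_count (p ^ i) n))"
    by (simp add: multiplicity_binomial_prod[OF assms(1)])
  also have "\<dots> = (\<Sum>i=1..k. real (n div p ^ i * p ^ i) - real (n div p ^ i)
                        - real (n div p ^ i) * real (n mod p ^ i))"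
  proof (rule sum.cong)
    fix i
    have "n mod p ^ i < p ^ i"
      using p1 by simp
    then have "real (p ^ i - 1 - n mod p ^ i) = real (p ^ i) - 1 - real (n mod p ^ i)"
      by linarith
    then show "real (borrow_count (p ^ i) n) = real (n div p ^ i * p ^ i) - real (n div p ^ i)
                        - real (n div p ^ i) * real (n mod p ^ i)"
      by (simp only: borrow_count_def of_nat_mult) (simp add: algebra_simps)
  qed simp
  also have "\<dots> = (\<Sum>i=1..k. real (n div p ^ i * p ^ i)) - (\<Sum>i=1..k. real (n div p ^ i))
                - (\<Sum>i=1..k. real (n div p ^ i) * real (n mod p ^ i))"
    by (simp only: sum_subtractf)
  also have "(\<Sum>i=1..k. real (n div p ^ i * p ^ i)) = (\<Sum>j=1..k. real j * real (a j) * real p ^ j)"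
  proof -
    have "(\<Sum>i=1..k. real (n div p ^ i * p ^ i)) =
        (\<Sum>i=1..k. \<Sum>v=i..k. real (a v) * real p ^ v)"
      by (intro sum.cong) (simp, subst high_times, auto)
    also have "\<dots> = (\<Sum>v=1..k. \<Sum>i=1..v. real (a v) * real p ^ v)"
      by (rule sum_triangle_swap)
    finally show ?thesis by (simp add: mult.assoc)
  qed
  also have "(\<Sum>i=1..k. real (n div p ^ i)) =
      (\<Sum>j=1..k. real (a j) * ((real p ^ j - 1) / (real p - 1)))"
  proof -
    have "(\<Sum>i=1..k. real (n div p ^ i)) =
        (\<Sum>i=1..k. \<Sum>v=i..k. real (a v) * real p ^ (v - i))"
      by (intro sum.cong) (simp_all add: high)
    also have "\<dots> = (\<Sum>v=1..k. real (a v) * (\<Sum>i=1..v. real p ^ (v - i)))"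
      by (simp only: sum_triangle_swap sum_distrib_left)
    finally show ?thesis
      using p1 by (simp add: sum_powers_down del: One_nat_def)
  qed
  also have "(\<Sum>i=1..k. real (n div p ^ i) * real (n mod p ^ i)) =
      (\<Sum>j=0..k. 1 / real p ^ (j + 1) * (\<Sum>u=0..j. real (a u) * real p ^ u)
            * (\<Sum>v=j+1..k. real (a v) * real p ^ v))"
  proof -
    \<comment> \<open>The right-hand side is indexed by \<open>j = i - 1\<close>; its last term \<open>j = k\<close> has an empty sum over \<open>v\<close>.\<close>
    have "(\<Sum>i=1..k. real (n div p ^ i) * real (n mod p ^ i)) =
        (\<Sum>j<k. real (n div p ^ Suc j) * real (n mod p ^ Suc j))"
      by (simp add: sum.atLeast1_atMost_eq del: power_Suc)
    also have "\<dots> = (\<Sum>j<k. 1 / real p ^ (j + 1) * (\<Sum>u=0..j. real (a u) * real p ^ u)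
            * (\<Sum>v=j+1..k. real (a v) * real p ^ v))"
    proof (rule sum.cong)
      fix j assume "j \<in> {..<k}"
      then have le: "Suc j \<le> Suc k" by simp
      have "(\<Sum>u=0..j. real (a u) * real p ^ u) = real (n mod p ^ Suc j)"
        by (simp add: low[OF _ le] lessThan_Suc_atMost atMost_atLeast0 del: power_Suc)
      moreover have "(\<Sum>v=j+1..k. real (a v) * real p ^ v) = real (n div p ^ Suc j * p ^ Suc j)"
        by (subst high_times[OF _ le]) auto
      ultimately show "real (n div p ^ Suc j) * real (n mod p ^ Suc j) =
          1 / real p ^ (j + 1) * (\<Sum>u=0..j. real (a u) * real p ^ u)
            * (\<Sum>v=j+1..k. real (a v) * real p ^ v)"
        using p1 by (simp del: power_Suc)
    qed simp
    finally show ?thesis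
      by (simp add: atLeast0AtMost lessThan_Suc_atMost[symmetric])
  qed
  finally show ?thesis by simp
qed

end
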